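(* Let $k\ge 1$ and let $X$ be a metric space with a base point $x_0\in X$ such that for some $M>0$ every bounded subset of $X$ can be covered by finitely many sets of diameter less than $M$. If $X$ is integrally $(k,k)$-quasi-geodesic, then the quasi-geodesic boundary $\partial_{QG}X$ of $X$ is compact metrizable and every point of it is the limit (in $X_{QG}$) of some integral $(k+2M,k+2M)$-quasi-geodesic ray $h$ based at $x_0$. Moreover, if $X$ is proper, then the quasi-geodesic compactification $X_{QG}$ of $X$ is compact metrizable.
   Context: $Z_+$ is the set of positive integers. For $q\ge 1$, $Q\ge 0$, an integral $(q,Q)$-quasi-geodesic in a metric space $(X,d)$ is a function $g:(a,b)\cap Z_+\to X$ (the interval may be unbounded) with $\frac{|x-y|}{q}-Q\le d(g(x),g(y))\le q|x-y|+Q$ for all $x,y$ in its domain. It originates (is based) at $x_0$ if $1$ is in its domain and $g(1)=x_0$; it is a ray if its domain is $Z_+$. $X$ is integrally $(q,Q)$-quasi-geodesic if every two points of $X$ can be joined by an integral $(q,Q)$-quasi-geodesic. For $k\ge 1$, $m\ge 1$ and an integral $(k,k)$-quasi-geodesic ray $g$ with $g(1)=x_0$, the $m$-cone $C_X(x_0,k,k,g,m)$ is the set of all $x\in X$ such that $x=h(i)$ for some $i\ge m$ and some integral $(k,k)$-quasi-geodesic $h$ (possibly with finite domain) with $h(1)=x_0$ and $h(j)=g(j)$ for all $j\le m$. A function $f:X\to\mathbb{C}$ is slowly-oscillating if $|f(x_n)-f(y_n)|\to 0$ whenever $x_n\to\infty$ (i.e. $d(x_0,x_n)\to\infty$) and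 $d(x_n,y_n)<M$ for all $n$, for some $M>0$. A bounded continuous slowly-oscillating function $f:X\to\mathbb{C}$ is geometrically slowly-oscillating if for every $\epsilon>0$, every $k\ge1$, every $x_0\in X$ and every integral $(k,k)$-quasi-geodesic ray $g$ in $X$ originating at $x_0$ there is $m\ge 1$ such that the diameter of $f(C_X(x_0,k,k,g,m))$ is smaller than $\epsilon$. $C_{QG}(X)$ is the $C^*$-algebra of all geometrically slowly-oscillating functions on $X$. The quasi-geodesic compactification $X_{QG}$ is the maximal ideal space of $C_{QG}(X)$ (equivalently, the compactification of $X$ such that the functions in $C_{QG}(X)$ are exactly the restrictions to $X$ of continuous functions $X_{QG}\to\mathbb{C}$). For proper $X$, the quasi-geodesic boundary is $\partial_{QG}X:=X_{QG}\setminus X$. If $X$ is not proper, $\partial_{QG}X$ is the set of points of $X_{QG}$ that are limits of integral quasi-geodesic rays in $X$. *)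

theory Defs
  imports "HOL-Analysis.Analysis"
begin

text \<open>
  The space \<open>X\<close> is the universe of a type of class \<^class>\<open>metric_space\<close>.
  A partial function on a set \<open>D\<close> of positive integers is represented by a total function on
  \<^typ>\<open>nat\<close> together with \<open>D\<close>; its values outside \<open>D\<close> are irrelevant.
\<close>

definition integral_interval :: "nat set \<Rightarrow> bool" where
  "integral_interval D \<longleftrightarrow>
     (\<exists>a b :: ereal. D = {n. 1 \<le> n \<and> a < ereal (real n) \<and> ereal (real n) < b})"

definition integral_quasi_geodesic ::
    "real \<Rightarrow> real \<Rightarrow> nat set \<Rightarrow> (nat \<Rightarrow> 'a::metric_space) \<Rightarrow> bool" where
  "integral_quasi_geodesic q Q D g \<longleftrightarrow>
     q \<ge> 1 \<and> Q \<ge> 0 \<and> integral_interval D \<and>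
     (\<forall>i\<in>D. \<forall>j\<in>D.
        \<bar>real i - real j\<bar> / q - Q \<le> dist (g i) (g j) \<and>
        dist (g i) (g j) \<le> q * \<bar>real i - real j\<bar> + Q)"

definition integral_quasi_geodesic_ray ::
    "real \<Rightarrow> real \<Rightarrow> (nat \<Rightarrow> 'a::metric_space) \<Rightarrow> bool" where
  "integral_quasi_geodesic_ray q Q g \<longleftrightarrow> integral_quasi_geodesic q Q {1..} g"

definition integrally_quasi_geodesic_space ::
    "'a::metric_space itself \<Rightarrow> real \<Rightarrow> real \<Rightarrow> bool" where
  "integrally_quasi_geodesic_space _ q Q \<longleftrightarrow>
     (\<forall>x y :: 'a. \<exists>g i j. 1 \<le> i \<and> i \<le> j \<and>
        integral_quasi_geodesic q Q {i..j} g \<and> g i = x \<and> g j = y)"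

text \<open>
  The domain \<open>D\<close> below is an interval containing \<open>1\<close> and some \<open>i \<ge> m\<close>, so it
  contains all of \<open>1, \<dots>, m\<close>.
\<close>

definition cone ::
    "'a::metric_space \<Rightarrow> real \<Rightarrow> real \<Rightarrow> (nat \<Rightarrow> 'a) \<Rightarrow> nat \<Rightarrow> 'a set" where
  "cone x0 q Q g m =
     {x. \<exists>D h i. integral_quasi_geodesic q Q D h \<and> 1 \<in> D \<and> h 1 = x0 \<and>
           (\<forall>j\<in>{1..m}. h j = g j) \<and> i \<in> D \<and> m \<le> i \<and> x = h i}"

text \<open>Whether a sequence tends to infinity does not depend on the base point \<open>p\<close>.\<close>

definition tends_to_infinity :: "(nat \<Rightarrow> 'a::metric_space) \<Rightarrow> bool" where
  "tends_to_infinity u \<longleftrightarrow> (\<forall>p. filterlim (\<lambda>n. dist p (u n)) at_top sequentially)"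

definition slowly_oscillating :: "('a::metric_space \<Rightarrow> complex) \<Rightarrow> bool" where
  "slowly_oscillating f \<longleftrightarrow>
     (\<forall>u v. tends_to_infinity u \<and> (\<exists>M>0. \<forall>n. dist (u n) (v n) < M) \<longrightarrow>
        (\<lambda>n. cmod (f (u n) - f (v n))) \<longlonglongrightarrow> 0)"

definition geometrically_slowly_oscillating :: "('a::metric_space \<Rightarrow> complex) \<Rightarrow> bool" where
  "geometrically_slowly_oscillating f \<longleftrightarrow>
     bounded (range f) \<and> continuous_on UNIV f \<and> slowly_oscillating f \<and>
     (\<forall>\<epsilon>>0. \<forall>k\<ge>1. \<forall>x0 g. integral_quasi_geodesic_ray k k g \<and> g 1 = x0 \<longrightarrow>
        (\<exists>m\<ge>1. diameter (f ` cone x0 k k g m) < \<epsilon>))"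

definition C_QG :: "'a::metric_space itself \<Rightarrow> ('a \<Rightarrow> complex) set" where
  "C_QG _ = {f. geometrically_slowly_oscillating f}"

text \<open>
  As usual in Gelfand theory, a maximal ideal is identified with the nonzero complex homomorphism
  of which it is the kernel, and the maximal ideal space carries the topology of pointwise
  convergence on the algebra. A homomorphism is an extensional function on the algebra
  (constantly \<^const>\<open>undefined\<close> elsewhere), as required by \<^const>\<open>product_topology\<close>.
\<close>

definition characters :: "('a \<Rightarrow> complex) set \<Rightarrow> (('a \<Rightarrow> complex) \<Rightarrow> complex) set" where
  "characters A = {\<phi> \<in> extensional A.
     (\<forall>f\<in>A. \<forall>g\<in>A. \<phi> (\<lambda>x. f x + g x) = \<phi> f + \<phi> g) \<and>
     (\<forall>c. \<forall>f\<in>A. \<phi> (\<lambda>x. c * f x) = c * \<phi> f) \<and>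
     (\<forall>f\<in>A. \<forall>g\<in>A. \<phi> (\<lambda>x. f x * g x) = \<phi> f * \<phi> g) \<and>
     (\<exists>f\<in>A. \<phi> f \<noteq> 0)}"

definition maximal_ideal_space ::
    "('a \<Rightarrow> complex) set \<Rightarrow> (('a \<Rightarrow> complex) \<Rightarrow> complex) topology" where
  "maximal_ideal_space A = subtopology (product_topology (\<lambda>_. euclidean) A) (characters A)"

definition X_QG :: "'a::metric_space itself \<Rightarrow> (('a \<Rightarrow> complex) \<Rightarrow> complex) topology" where
  "X_QG T = maximal_ideal_space (C_QG T)"

text \<open>The canonical map of \<open>X\<close> into its compactification, sending a point to evaluation at it.\<close>

definition to_X_QG :: "'a::metric_space \<Rightarrow> (('a \<Rightarrow> complex) \<Rightarrow> complex)" where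
  "to_X_QG x = (\<lambda>f\<in>C_QG TYPE('a). f x)"

definition limit_in_X_QG ::
    "(nat \<Rightarrow> 'a::metric_space) \<Rightarrow> (('a \<Rightarrow> complex) \<Rightarrow> complex) \<Rightarrow> bool" where
  "limit_in_X_QG g p \<longleftrightarrow> limitin (X_QG TYPE('a)) (\<lambda>n. to_X_QG (g n)) p sequentially"

definition proper_space :: "'a::metric_space itself \<Rightarrow> bool" where
  "proper_space _ \<longleftrightarrow> (\<forall>S :: 'a set. closed S \<and> bounded S \<longrightarrow> compact S)"

definition boundary_QG :: "'a::metric_space itself \<Rightarrow> (('a \<Rightarrow> complex) \<Rightarrow> complex) set" where
  "boundary_QG T =
     (if proper_space T then topspace (X_QG T) - range to_X_QG
      else {p. \<exists>q Q g. integral_quasi_geodesic_ray q Q g \<and> limit_in_X_QG g p})"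

end

theory Submission
  imports Defs
begin

text \<open>
  Let \<open>K = k + 2 M\<close>. The points of the boundary are the characters \<open>p\<close> that vanish on all functions
  of bounded support, and they are recognised by which subsets of \<open>X\<close> have \<open>p\<close> in their closure;
  call such sets adherent to \<open>p\<close>. Since the algebra contains the inverses of its members that are
  bounded away from zero, \<open>X\<close> itself is adherent to every character
  (\<open>character_adherent_UNIV\<close>). For \<open>p\<close> at infinity, no bounded set is adherent
  (\<open>not_adherent_bounded\<close>). A finite union is adherent only if one of its terms is.

  Fix a finite \<open>M\<close>-net \<open>F i\<close> of a large enough ball around \<open>x0\<close> for every time \<open>i\<close>, and for every
  point \<open>x\<close> a \<open>(k, k)\<close>-quasi-geodesic from \<open>x0\<close> to \<open>x\<close>. Rounding this path to the nets encodes \<open>x\<close>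
  by a sequence with finitely many options in every place. The argument of Koenig's lemma, with
  adherent sets in the role of infinite sets, gives a sequence \<open>g\<close> such that for all \<open>m\<close> the points
  whose code starts with \<open>g 1, \<dots>, g m\<close> form a set adherent to \<open>p\<close>. Rounding costs \<open>2 M\<close> in the
  distances, so \<open>g\<close> is a \<open>(K, K)\<close>-quasi-geodesic ray, and the points in question lie in the
  \<open>m\<close>-cone of \<open>g\<close>, because the rounded initial piece of the path to such a point can be replaced by
  that of \<open>g\<close> (\<open>point_at_infinity_is_limit_of_net_ray\<close>). Functions of the algebra have
  small oscillation on late cones, and these cones are adherent to \<open>p\<close> and contain the tail of \<open>g\<close>,
  so \<open>g\<close> converges to \<open>p\<close> (\<open>adherent_cones_imp_limit\<close>).

  The maximal ideal space is compact and the boundary is closed in it. A compact set of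
  characters is metrizable as soon as countably many members of the algebra separate its points.
  A cone depends only on a finite initial piece of its ray, so the rays in the nets have
  only countably many cones. Every boundary point is adherent to cones from this countable collection on
  which a given function oscillates arbitrarily little, hence choosing one function for each pair of
  cones that some function separates is enough to separate the boundary
  (\<open>countable_separating_family\<close>). If \<open>X\<close> is proper, it is separable and every character outside the
  boundary is evaluation at a point; adding countably many functions of bounded support
  then separates the whole compactification.
\<close>

section \<open>The algebra of geometrically slowly-oscillating functions\<close>

lemma C_QG_I:
  fixes f :: "'a::metric_space \<Rightarrow> complex"
  assumes "bounded (range f)" "continuous_on UNIV f" "slowly_oscillating f"
    and "\<And>\<epsilon> k g. \<lbrakk>\<epsilon> > 0; k \<ge> 1; integral_quasi_geodesic_ray k k g\<rbrakk>
           \<Longrightarrow> \<exists>m\<ge>1. diameter (f ` cone (g 1) k k g m) < \<epsilon>"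
  shows "f \<in> C_QG TYPE('a)"
  using assms unfolding C_QG_def geometrically_slowly_oscillating_def by blast

lemma cone_antimono: "m \<le> n \<Longrightarrow> cone x0 q Q g n \<subseteq> cone x0 q Q g m"
  unfolding cone_def by fastforce

lemma ray_in_cone:
  assumes "integral_quasi_geodesic_ray q Q g" "1 \<le> m" "m \<le> n"
  shows "g n \<in> cone (g 1) q Q g m"
proof -
  have "integral_quasi_geodesic q Q {1..} g \<and> 1 \<in> {1::nat..} \<and> g 1 = g 1 \<and>
      (\<forall>j\<in>{1..m}. g j = g j) \<and> n \<in> {1..} \<and> m \<le> n \<and> g n = g n"
    using assms by (simp add: integral_quasi_geodesic_ray_def)
  then show ?thesis
    unfolding cone_def by blast
qed

lemma C_QG_bounded_image:
  fixes f :: "'a::metric_space \<Rightarrow> complex"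
  shows "f \<in> C_QG TYPE('a) \<Longrightarrow> bounded (f ` B)"
  unfolding C_QG_def geometrically_slowly_oscillating_def
  by (auto intro: bounded_subset[of "range f"])

lemma C_QG_continuous:
  fixes f :: "'a::metric_space \<Rightarrow> complex"
  shows "f \<in> C_QG TYPE('a) \<Longrightarrow> continuous_on UNIV f"
  by (simp add: C_QG_def geometrically_slowly_oscillating_def)

lemma C_QG_small_on_cone:
  fixes f :: "'a::metric_space \<Rightarrow> complex"
  assumes "f \<in> C_QG TYPE('a)" "\<epsilon> > 0" "integral_quasi_geodesic_ray k k g"
  shows "\<exists>m\<ge>1. \<forall>x\<in>cone (g 1) k k g m. \<forall>y\<in>cone (g 1) k k g m. dist (f x) (f y) < \<epsilon>"
proof -
  have "k \<ge> 1"
    using assms(3) by (simp add: integral_quasi_geodesic_ray_def integral_quasi_geodesic_def)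
  then obtain m where m: "m \<ge> 1" "diameter (f ` cone (g 1) k k g m) < \<epsilon>"
    using assms unfolding C_QG_def geometrically_slowly_oscillating_def by blast
  have "dist (f x) (f y) < \<epsilon>" if "x \<in> cone (g 1) k k g m" "y \<in> cone (g 1) k k g m" for x y
    using diameter_bounded_bound[OF C_QG_bounded_image[OF assms(1)] imageI[OF that(1)] imageI[OF that(2)]]
      m(2) by linarith
  with m(1) show ?thesis by blast
qed

text \<open>
  Every condition defining the algebra bounds variations \<open>\<bar>f x - f y\<bar>\<close>, so a function whose
  variation is dominated by the variations of two members is a member. The closure properties of
  the algebra are all instances of this.
\<close>

lemma C_QG_dominated:
  fixes u f g :: "'a::metric_space \<Rightarrow> complex"
  assumes f: "f \<in> C_QG TYPE('a)" and g: "g \<in> C_QG TYPE('a)" and L: "L > 0"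
    and dom: "\<And>x y. dist (u x) (u y) \<le> L * (dist (f x) (f y) + dist (g x) (g y))"
  shows "u \<in> C_QG TYPE('a)"
proof (rule C_QG_I)
  obtain a :: 'a where True by simp
  obtain Bf where Bf: "\<And>x. dist (f a) (f x) \<le> Bf"
    using C_QG_bounded_image[OF f, of UNIV] unfolding bounded_any_center[where a = "f a"] by blast
  obtain Bg where Bg: "\<And>x. dist (g a) (g x) \<le> Bg"
    using C_QG_bounded_image[OF g, of UNIV] unfolding bounded_any_center[where a = "g a"] by blast
  have "dist (u a) (u x) \<le> L * (Bf + Bg)" for x
  proof -
    have "L * (dist (f a) (f x) + dist (g a) (g x)) \<le> L * (Bf + Bg)"
      using Bf[of x] Bg[of x] L by (intro mult_left_mono) auto
    with dom[of a x] show ?thesis by linarith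
  qed
  then show "bounded (range u)"
    unfolding bounded_def by blast
next
  have "(u \<longlongrightarrow> u x) (at x)" for x
  proof -
    have "(f \<longlongrightarrow> f x) (at x)" "(g \<longlongrightarrow> g x) (at x)"
      using C_QG_continuous[OF f] C_QG_continuous[OF g] by (simp_all add: continuous_on_def)
    then have fg: "((\<lambda>y. dist (f y) (f x)) \<longlongrightarrow> 0) (at x)" "((\<lambda>y. dist (g y) (g x)) \<longlongrightarrow> 0) (at x)"
      by (simp_all only: tendsto_dist_iff[symmetric])
    have "((\<lambda>y. L * (dist (f y) (f x) + dist (g y) (g x))) \<longlongrightarrow> 0) (at x)"
      using tendsto_mult_right_zero[OF tendsto_add_zero[OF fg]] by simp
    then have "((\<lambda>y. dist (u y) (u x)) \<longlongrightarrow> 0) (at x)"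
      by (rule Lim_null_comparison[rotated]) (use dom[of _ x] in simp)
    then show ?thesis by (simp only: tendsto_dist_iff[symmetric])
  qed
  then show "continuous_on UNIV u"
    by (simp add: continuous_on_def)
next
  show "slowly_oscillating u"
    unfolding slowly_oscillating_def
  proof (intro allI impI)
    fix s t :: "nat \<Rightarrow> 'a"
    assume st: "tends_to_infinity s \<and> (\<exists>M>0. \<forall>n. dist (s n) (t n) < M)"
    have "(\<lambda>n. dist (f (s n)) (f (t n))) \<longlonglongrightarrow> 0" "(\<lambda>n. dist (g (s n)) (g (t n))) \<longlonglongrightarrow> 0"
      using f g st
      unfolding C_QG_def geometrically_slowly_oscillating_def slowly_oscillating_def dist_norm mem_Collect_eq
      by blast+
    then have "(\<lambda>n. L * (dist (f (s n)) (f (t n)) + dist (g (s n)) (g (t n)))) \<longlonglongrightarrow> 0"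
      by (intro tendsto_mult_right_zero tendsto_add_zero)
    then have "(\<lambda>n. dist (u (s n)) (u (t n))) \<longlonglongrightarrow> 0"
      by (rule Lim_null_comparison[rotated]) (use dom in simp)
    then show "(\<lambda>n. cmod (u (s n) - u (t n))) \<longlonglongrightarrow> 0"
      by (simp add: dist_norm)
  qed
next
  fix \<epsilon> k :: real and r :: "nat \<Rightarrow> 'a"
  assume \<epsilon>: "\<epsilon> > 0" and r: "integral_quasi_geodesic_ray k k r"
  \<comment> \<open>With this choice \<open>L (\<delta> + \<delta>) = \<epsilon> / 2\<close>; the strict bound is needed after passing to a supremum.\<close>
  define \<delta> where "\<delta> = \<epsilon> / (4 * L)"
  have \<delta>: "\<delta> > 0" using \<epsilon> L by (simp add: \<delta>_def)
  obtain m where m: "m \<ge> 1"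
    "\<forall>x\<in>cone (r 1) k k r m. \<forall>y\<in>cone (r 1) k k r m. dist (f x) (f y) < \<delta>"
    using C_QG_small_on_cone[OF f \<delta> r] by blast
  obtain n where n: "n \<ge> 1"
    "\<forall>x\<in>cone (r 1) k k r n. \<forall>y\<in>cone (r 1) k k r n. dist (g x) (g y) < \<delta>"
    using C_QG_small_on_cone[OF g \<delta> r] by blast
  have "dist (u x) (u y) \<le> \<epsilon> / 2"
    if "x \<in> cone (r 1) k k r (max m n)" "y \<in> cone (r 1) k k r (max m n)" for x y
  proof -
    have "dist (f x) (f y) < \<delta>" "dist (g x) (g y) < \<delta>"
      using that m(2) n(2) cone_antimono[of m "max m n" "r 1" k k r]
        cone_antimono[of n "max m n" "r 1" k k r] by (simp_all add: subset_iff)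
    then have "L * (dist (f x) (f y) + dist (g x) (g y)) \<le> L * (\<delta> + \<delta>)"
      using L by simp
    also have "\<dots> = \<epsilon> / 2" using L by (simp add: \<delta>_def)
    finally show ?thesis using dom[of x y] by linarith
  qed
  then have "diameter (u ` cone (r 1) k k r (max m n)) \<le> \<epsilon> / 2"
    unfolding dist_norm using \<epsilon> by (intro diameter_le) (simp, blast)
  then have "1 \<le> max m n \<and> diameter (u ` cone (r 1) k k r (max m n)) < \<epsilon>"
    using \<epsilon> m(1) by linarith
  then show "\<exists>m\<ge>1. diameter (u ` cone (r 1) k k r m) < \<epsilon>" by blast
qed

lemma far_out_in_cone:
  assumes "x \<in> cone x0 k k g m" "m \<ge> 1" "k \<ge> 1"
  shows "(real m - 1) / k - k \<le> dist x0 x"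
proof -
  obtain D h i where h: "integral_quasi_geodesic k k D h" "1 \<in> D" "h 1 = x0" "i \<in> D" "m \<le> i" "x = h i"
    using assms(1) unfolding cone_def by blast
  then have "\<bar>real 1 - real i\<bar> / k - k \<le> dist (h 1) (h i)"
    unfolding integral_quasi_geodesic_def by blast
  moreover have "(real m - 1) / k \<le> \<bar>real 1 - real i\<bar> / k"
    using h(5) assms by (intro divide_right_mono) auto
  ultimately show ?thesis using h by simp
qed

definition bump :: "'a::metric_space \<Rightarrow> real \<Rightarrow> 'a \<Rightarrow> complex" where
  "bump t r x = of_real (max 0 (r - dist t x))"

lemma bump_eq_0_iff: "bump t r x = 0 \<longleftrightarrow> r \<le> dist t x"
  by (auto simp: bump_def max_def)

text \<open>
  A bump vanishes far away from its centre, and both oscillation conditions only look far away: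
  cones beyond a late time avoid any given ball.
\<close>

lemma bump_in_C_QG:
  fixes t :: "'a::metric_space"
  shows "bump t r \<in> C_QG TYPE('a)"
proof (rule C_QG_I)
  show "bounded (range (bump t r))"
    unfolding bounded_iff bump_def norm_of_real
    by (rule exI[of _ "\<bar>r\<bar>"]) (smt (verit) image_iff norm_of_real zero_le_dist)
  show "continuous_on UNIV (bump t r)"
    unfolding bump_def by (intro continuous_intros)
  show "slowly_oscillating (bump t r)"
    unfolding slowly_oscillating_def
  proof (intro allI impI)
    fix u v :: "nat \<Rightarrow> 'a"
    assume uv: "tends_to_infinity u \<and> (\<exists>M>0. \<forall>n. dist (u n) (v n) < M)"
    then obtain M where M: "M > 0" "\<And>n. dist (u n) (v n) < M" by blast
    have "\<forall>\<^sub>F n in sequentially. r + M \<le> dist t (u n)"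
      using uv unfolding tends_to_infinity_def filterlim_at_top by blast
    then have "\<forall>\<^sub>F n in sequentially. cmod (bump t r (u n) - bump t r (v n)) = 0"
    proof eventually_elim
      case (elim n)
      have "r \<le> dist t (u n)" "r \<le> dist t (v n)"
        using elim M(1) M(2)[of n] dist_triangle[of t "u n" "v n"] by (auto simp: dist_commute)
      then show ?case by (simp add: bump_eq_0_iff[THEN iffD2])
    qed
    then show "(\<lambda>n. cmod (bump t r (u n) - bump t r (v n))) \<longlonglongrightarrow> 0"
      by (rule tendsto_eventually)
  qed
next
  fix \<epsilon> k :: real and g :: "nat \<Rightarrow> 'a"
  assume \<epsilon>: "\<epsilon> > 0" and k: "k \<ge> 1"
  obtain m where m: "(r + dist t (g 1) + k) * k + 1 \<le> real m" "m \<ge> 1"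
    by (metis linorder_le_cases of_nat_1 order.trans real_arch_simple of_nat_mono)
  have "bump t r x = 0" if "x \<in> cone (g 1) k k g m" for x
  proof -
    have "r + dist t (g 1) + k \<le> (real m - 1) / k"
      using m k by (simp add: field_simps)
    then have "r + dist t (g 1) \<le> dist (g 1) x"
      using far_out_in_cone[OF that m(2) k] by linarith
    then show ?thesis
      using dist_triangle[of "g 1" x t] by (simp add: bump_eq_0_iff dist_commute)
  qed
  then have "diameter (bump t r ` cone (g 1) k k g m) \<le> 0"
    by (intro diameter_le) auto
  then have "1 \<le> m \<and> diameter (bump t r ` cone (g 1) k k g m) < \<epsilon>"
    using \<epsilon> m(2) by linarith
  then show "\<exists>m\<ge>1. diameter (bump t r ` cone (g 1) k k g m) < \<epsilon>" by blast
qed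

lemma C_QG_const: "(\<lambda>_. c) \<in> C_QG TYPE('a::metric_space)"
  by (rule C_QG_dominated[OF bump_in_C_QG bump_in_C_QG, of 1]) auto

lemma C_QG_add:
  fixes f g :: "'a::metric_space \<Rightarrow> complex"
  assumes "f \<in> C_QG TYPE('a)" "g \<in> C_QG TYPE('a)"
  shows "(\<lambda>x. f x + g x) \<in> C_QG TYPE('a)"
  by (rule C_QG_dominated[OF assms, of 1]) (auto intro: dist_triangle_add)

lemma C_QG_mult:
  fixes f g :: "'a::metric_space \<Rightarrow> complex"
  assumes "f \<in> C_QG TYPE('a)" "g \<in> C_QG TYPE('a)"
  shows "(\<lambda>x. f x * g x) \<in> C_QG TYPE('a)"
proof -
  obtain a b where ab: "\<And>x. cmod (f x) \<le> a" "\<And>x. cmod (g x) \<le> b" "a > 0" "b > 0"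
    using C_QG_bounded_image[OF assms(1), of UNIV] C_QG_bounded_image[OF assms(2), of UNIV]
    unfolding bounded_pos by blast
  show ?thesis
  proof (rule C_QG_dominated[OF assms, of "a + b"])
    fix x y
    have "f x * g x - f y * g y = f x * (g x - g y) + (f x - f y) * g y"
      by (simp add: algebra_simps)
    then have "dist (f x * g x) (f y * g y) \<le> cmod (f x) * dist (g x) (g y) + dist (f x) (f y) * cmod (g y)"
      unfolding dist_norm by (metis norm_mult norm_triangle_ineq)
    also have "\<dots> \<le> (a + b) * dist (g x) (g y) + dist (f x) (f y) * (a + b)"
      using ab(1)[of x] ab(2)[of y] ab(3,4)
      by (intro add_mono mult_mono) auto
    finally show "dist (f x * g x) (f y * g y) \<le> (a + b) * (dist (f x) (f y) + dist (g x) (g y))"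
      by (simp add: algebra_simps)
  qed (use ab(3,4) in simp)
qed

lemma C_QG_cnj:
  fixes f :: "'a::metric_space \<Rightarrow> complex"
  assumes "f \<in> C_QG TYPE('a)"
  shows "(\<lambda>x. cnj (f x)) \<in> C_QG TYPE('a)"
proof (rule C_QG_dominated[OF assms assms, of 1])
  show "dist (cnj (f x)) (cnj (f y)) \<le> 1 * (dist (f x) (f y) + dist (f x) (f y))" for x y
    by (simp add: dist_norm flip: complex_cnj_diff)
qed simp

text \<open>
  Inversion is Lipschitz with constant \<open>1 / c\<^sup>2\<close> outside the disc of radius \<open>c\<close>.
\<close>

lemma C_QG_inverse:
  fixes f :: "'a::metric_space \<Rightarrow> complex"
  assumes f: "f \<in> C_QG TYPE('a)" and c: "c > 0" "\<And>x. cmod (f x) \<ge> c"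
  shows "(\<lambda>x. inverse (f x)) \<in> C_QG TYPE('a)"
proof (rule C_QG_dominated[OF f f, of "inverse c * inverse c"])
  fix x y
  have nz: "f x \<noteq> 0" "f y \<noteq> 0" using c(1) c(2)[of x] c(2)[of y] by auto
  have inv: "cmod (inverse (f z)) \<le> inverse c" for z
    using c(1) c(2)[of z] by (simp add: norm_inverse le_imp_inverse_le)
  have "dist (inverse (f x)) (inverse (f y))
      = cmod (inverse (f x)) * cmod (inverse (f y)) * dist (f x) (f y)"
    using nz by (simp add: dist_norm inverse_diff_inverse norm_mult)
  also have "\<dots> \<le> inverse c * inverse c * dist (f x) (f y)"
    using inv c(1) by (intro mult_mono) auto
  also have "\<dots> \<le> inverse c * inverse c * (dist (f x) (f y) + dist (f x) (f y))"
    using c(1) by (intro mult_left_mono) auto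
  finally show "dist (inverse (f x)) (inverse (f y))
      \<le> inverse c * inverse c * (dist (f x) (f y) + dist (f x) (f y))" .
qed (use c(1) in simp)


section \<open>Maximal ideal spaces of function algebras\<close>

lemma character_values:
  assumes "\<phi> \<in> characters A" "f \<in> A"
  shows character_add: "g \<in> A \<Longrightarrow> \<phi> (\<lambda>x. f x + g x) = \<phi> f + \<phi> g"
    and character_scale: "\<phi> (\<lambda>x. c * f x) = c * \<phi> f"
    and character_mult: "g \<in> A \<Longrightarrow> \<phi> (\<lambda>x. f x * g x) = \<phi> f * \<phi> g"
  using assms unfolding characters_def by blast+

lemma character_extensional: "\<phi> \<in> characters A \<Longrightarrow> \<phi> \<in> extensional A"
  unfolding characters_def by blast

lemma character_one:
  assumes "\<phi> \<in> characters A" "(\<lambda>_. 1) \<in> A"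
  shows "\<phi> (\<lambda>_. 1) = 1"
proof -
  obtain f where f: "f \<in> A" "\<phi> f \<noteq> 0"
    using assms(1) unfolding characters_def by blast
  have "\<phi> f = \<phi> f * \<phi> (\<lambda>_. 1)"
    using character_mult[OF assms(1) f(1) assms(2)] by simp
  with f(2) show ?thesis by simp
qed

lemma character_const:
  assumes "\<phi> \<in> characters A" "(\<lambda>_. 1) \<in> A"
  shows "\<phi> (\<lambda>_. c) = c"
  using character_scale[OF assms, of c] character_one[OF assms] by simp

lemma topspace_maximal_ideal_space [simp]: "topspace (maximal_ideal_space A) = characters A"
  unfolding maximal_ideal_space_def
  by (auto simp: characters_def PiE_def)

lemma continuous_map_character_eval:
  assumes "f \<in> A"
  shows "continuous_map (maximal_ideal_space A) euclidean (\<lambda>\<phi>. \<phi> f)"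
  unfolding maximal_ideal_space_def
  using assms by (intro continuous_map_from_subtopology continuous_map_product_projection)

lemma character_eqI:
  assumes "\<phi> \<in> characters A" "\<psi> \<in> characters A" "\<And>f. f \<in> A \<Longrightarrow> \<phi> f = \<psi> f"
  shows "\<phi> = \<psi>"
  using assms unfolding characters_def by (auto intro: extensionalityI)

lemma limitin_maximal_ideal_space:
  assumes "\<And>n. u n \<in> characters A"
  shows "limitin (maximal_ideal_space A) u \<phi> F \<longleftrightarrow>
    \<phi> \<in> characters A \<and> (\<forall>f\<in>A. ((\<lambda>n. u n f) \<longlongrightarrow> \<phi> f) F)"
proof -
  have "u n \<in> extensional A" for n
    using assms by (rule character_extensional)
  then show ?thesis
    using assms character_extensional
    by (auto simp: maximal_ideal_space_def limitin_subtopology limitin_componentwise PiE_def)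
qed

lemma closedin_Collect_ball:
  assumes "\<And>i. i \<in> I \<Longrightarrow> closedin X {x \<in> topspace X. Q i x}"
  shows "closedin X {x \<in> topspace X. \<forall>i\<in>I. Q i x}"
proof (cases "I = {}")
  case False
  then have "{x \<in> topspace X. \<forall>i\<in>I. Q i x} = (\<Inter>i\<in>I. {x \<in> topspace X. Q i x})"
    by auto
  then show ?thesis
    using False assms by (metis (no_types, lifting) closedin_INT)
qed simp

text \<open>
  Characters bounded by fixed constants form a closed subset of a product of discs, because
  each algebraic identity is a closed condition. The condition of not vanishing identically is closed
  too, in the form \<open>\<phi> 1 = 1\<close>.
\<close>

lemma compact_maximal_ideal_space:
  assumes one: "(\<lambda>_. 1) \<in> A"
    and add: "\<And>f g. \<lbrakk>f \<in> A; g \<in> A\<rbrakk> \<Longrightarrow> (\<lambda>x. f x + g x) \<in> A"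
    and mult: "\<And>f g. \<lbrakk>f \<in> A; g \<in> A\<rbrakk> \<Longrightarrow> (\<lambda>x. f x * g x) \<in> A"
    and scale: "\<And>c f. f \<in> A \<Longrightarrow> (\<lambda>x. c * f x) \<in> A"
    and bound: "\<And>\<phi> f. \<lbrakk>\<phi> \<in> characters A; f \<in> A\<rbrakk> \<Longrightarrow> cmod (\<phi> f) \<le> b f"
  shows "compact_space (maximal_ideal_space A)"
proof -
  let ?P = "product_topology (\<lambda>_. euclidean) A :: (('a \<Rightarrow> complex) \<Rightarrow> complex) topology"
  have proj: "continuous_map ?P euclidean (\<lambda>\<phi>. \<phi> f)" if "f \<in> A" for f
    using that by (rule continuous_map_product_projection)
  have cmult: "continuous_map ?P euclidean (\<lambda>\<phi>. \<phi> f * \<phi> g)" if "f \<in> A" "g \<in> A" for f g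
    using proj[OF that(1)] proj[OF that(2)] by (simp add: continuous_map_atin tendsto_mult)
  have cscale: "continuous_map ?P euclidean (\<lambda>\<phi>. c * \<phi> f)" if "f \<in> A" for c f
    using proj[OF that] by (simp add: continuous_map_atin tendsto_mult)
  note closed_eq = closedin_continuous_maps_eq[OF Hausdorff_space_euclidean]
  have "closedin ?P {\<phi> \<in> topspace ?P. \<forall>f\<in>A. \<forall>g\<in>A. \<phi> (\<lambda>x. f x + g x) = \<phi> f + \<phi> g}"
    by (intro closedin_Collect_ball closed_eq continuous_map_add proj add; assumption)
  moreover have "closedin ?P {\<phi> \<in> topspace ?P. \<forall>c\<in>UNIV. \<forall>f\<in>A. \<phi> (\<lambda>x. c * f x) = c * \<phi> f}"
    by (intro closedin_Collect_ball closed_eq cscale proj scale; assumption)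
  moreover have "closedin ?P {\<phi> \<in> topspace ?P. \<forall>f\<in>A. \<forall>g\<in>A. \<phi> (\<lambda>x. f x * g x) = \<phi> f * \<phi> g}"
    by (intro closedin_Collect_ball closed_eq cmult proj mult; assumption)
  moreover have "closedin ?P {\<phi> \<in> topspace ?P. \<phi> (\<lambda>_. 1) = 1}"
    by (intro closed_eq proj one) simp
  moreover have "characters A =
      {\<phi> \<in> topspace ?P. \<forall>f\<in>A. \<forall>g\<in>A. \<phi> (\<lambda>x. f x + g x) = \<phi> f + \<phi> g}
    \<inter> ({\<phi> \<in> topspace ?P. \<forall>c\<in>UNIV. \<forall>f\<in>A. \<phi> (\<lambda>x. c * f x) = c * \<phi> f}
    \<inter> ({\<phi> \<in> topspace ?P. \<forall>f\<in>A. \<forall>g\<in>A. \<phi> (\<lambda>x. f x * g x) = \<phi> f * \<phi> g}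
    \<inter> {\<phi> \<in> topspace ?P. \<phi> (\<lambda>_. 1) = 1}))" (is "_ = ?R")
  proof (intro equalityI subsetI)
    fix \<phi> assume "\<phi> \<in> ?R"
    moreover from this have "\<exists>f\<in>A. \<phi> f \<noteq> 0"
      using one by (intro bexI[of _ "\<lambda>_. 1"]) simp_all
    ultimately show "\<phi> \<in> characters A"
      unfolding characters_def by (simp add: PiE_def)
  next
    fix \<phi> assume \<phi>: "\<phi> \<in> characters A"
    with character_one[OF this one] show "\<phi> \<in> ?R"
      unfolding characters_def by (simp add: PiE_def)
  qed
  ultimately have closed: "closedin ?P (characters A)"
    by (simp only: closedin_Int)
  have "compactin ?P (\<Pi>\<^sub>E f\<in>A. cball 0 (b f))"
    unfolding compactin_PiE by (simp only: compactin_euclidean_iff compact_cball) blast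
  moreover have "characters A \<subseteq> (\<Pi>\<^sub>E f\<in>A. cball 0 (b f))"
    using bound by (intro subsetI PiE_I) (simp, metis character_extensional extensional_arb)
  ultimately have "compactin ?P (characters A)"
    using closed closed_compactin by blast
  then show ?thesis
    unfolding maximal_ideal_space_def by (rule compact_space_subtopology)
qed

text \<open>
  Evaluation at countably many separating members embeds a compact set into a countable power of
  the plane.
\<close>

lemma metrizable_if_countably_separated:
  assumes K: "compactin (maximal_ideal_space A) K"
    and S: "countable S" "S \<subseteq> A"
    and sep: "\<And>\<phi> \<psi>. \<lbrakk>\<phi> \<in> K; \<psi> \<in> K; \<phi> \<noteq> \<psi>\<rbrakk> \<Longrightarrow> \<exists>f\<in>S. \<phi> f \<noteq> \<psi> f"
  shows "metrizable_space (subtopology (maximal_ideal_space A) K)"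
proof -
  let ?Z = "subtopology (maximal_ideal_space A) K"
  let ?P = "product_topology (\<lambda>_. euclidean) S :: (('a \<Rightarrow> complex) \<Rightarrow> complex) topology"
  have "countable {f \<in> S. \<not> (\<exists>a. topspace (euclidean :: complex topology) \<subseteq> {a})}"
    using S(1) by (rule countable_subset[rotated]) blast
  then have met: "metrizable_space ?P"
    using metrizable_space_euclidean by (subst metrizable_space_product_topology) blast
  have "continuous_map ?Z euclidean (\<lambda>\<phi>. restrict \<phi> S f)" if "f \<in> S" for f
    using that S(2) continuous_map_from_subtopology[OF continuous_map_character_eval] by auto
  then have "continuous_map ?Z ?P (\<lambda>\<phi>. restrict \<phi> S)"
    by (subst continuous_map_componentwise) auto
  moreover have "Hausdorff_space ?P"
    by (simp add: Hausdorff_space_product_topology)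
  moreover have "inj_on (\<lambda>\<phi>. restrict \<phi> S) (topspace ?Z)"
    using sep by (intro inj_onI) (metis IntD2 restrict_apply' topspace_subtopology)
  ultimately have "embedding_map ?Z ?P (\<lambda>\<phi>. restrict \<phi> S)"
    using K by (intro continuous_imp_embedding_map compact_space_subtopology)
  then have "?Z homeomorphic_space subtopology ?P ((\<lambda>\<phi>. restrict \<phi> S) ` topspace ?Z)"
    by (rule embedding_map_imp_homeomorphic_space)
  then show ?thesis
    using met metrizable_space_subtopology homeomorphic_metrizable_space by blast
qed

section \<open>Approximating characters by points of the space\<close>

text \<open>
  This says that \<open>p\<close> lies in the closure of the image of \<open>B\<close> in the compactification; the
  quantifiers over \<open>S\<close> and \<open>\<epsilon>\<close> spell out the basic neighbourhoods of \<open>p\<close>.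
\<close>

definition adherent :: "(('a::metric_space \<Rightarrow> complex) \<Rightarrow> complex) \<Rightarrow> 'a set \<Rightarrow> bool" where
  "adherent p B \<longleftrightarrow> (\<forall>S \<epsilon>. finite S \<and> S \<subseteq> C_QG TYPE('a) \<and> \<epsilon> > 0 \<longrightarrow>
     (\<exists>x\<in>B. \<forall>f\<in>S. dist (f x) (p f) < \<epsilon>))"

lemma adherent_mono: "\<lbrakk>adherent p B; B \<subseteq> C\<rbrakk> \<Longrightarrow> adherent p C"
  unfolding adherent_def by (meson subsetD)

lemma not_adherent_empty: "\<not> adherent p {}"
  unfolding adherent_def by (metis empty_iff empty_subsetI finite.emptyI zero_less_one)

lemma adherent_UnD:
  assumes "adherent p (B \<union> C)"
  shows "adherent p B \<or> adherent p C"
proof (rule ccontr)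
  assume "\<not> ?thesis"
  then have not: "\<not> adherent p B" "\<not> adherent p C" by simp_all
  obtain S \<epsilon> where S: "finite S" "S \<subseteq> C_QG TYPE('a)" "\<epsilon> > 0"
      "\<not> (\<exists>x\<in>B. \<forall>f\<in>S. dist (f x) (p f) < \<epsilon>)"
    using not(1) unfolding adherent_def by blast
  obtain T \<delta> where T: "finite T" "T \<subseteq> C_QG TYPE('a)" "\<delta> > 0"
      "\<not> (\<exists>x\<in>C. \<forall>f\<in>T. dist (f x) (p f) < \<delta>)"
    using not(2) unfolding adherent_def by blast
  have "finite (S \<union> T) \<and> S \<union> T \<subseteq> C_QG TYPE('a) \<and> min \<epsilon> \<delta> > 0"
    using S T by simp
  then obtain x where "x \<in> B \<union> C" "\<forall>f\<in>S \<union> T. dist (f x) (p f) < min \<epsilon> \<delta>"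
    using assms unfolding adherent_def by blast
  then have "x \<in> B \<or> x \<in> C" "\<forall>f\<in>S. dist (f x) (p f) < \<epsilon>" "\<forall>f\<in>T. dist (f x) (p f) < \<delta>"
    by simp_all
  with S(4) T(4) show False by blast
qed

lemma adherent_UN_D:
  assumes "finite I" "adherent p (\<Union>i\<in>I. B i)"
  shows "\<exists>i\<in>I. adherent p (B i)"
  using assms
proof (induction I rule: finite_induct)
  case empty
  then show ?case by (simp add: not_adherent_empty)
next
  case (insert i I)
  then show ?case using adherent_UnD[of p "B i"] by auto
qed

lemma adherentE:
  fixes f :: "'a::metric_space \<Rightarrow> complex"
  assumes "adherent p B" "f \<in> C_QG TYPE('a)" "\<epsilon> > 0"
  obtains x where "x \<in> B" "dist (f x) (p f) < \<epsilon>"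
  using assms unfolding adherent_def
  by (metis empty_subsetI finite.emptyI finite_insert insertI1 insert_subset)

text \<open>
  The points of \<open>X\<close> are dense in the maximal ideal space: a character vanishes on \<open>F = (\<Sum>f\<in>S. \<bar>f - p f\<bar>\<^sup>2)\<close>, so \<open>F\<close> is not invertible; as the algebra
  contains the inverses of functions bounded away from zero, \<open>F\<close> takes arbitrarily small values.
\<close>

lemma character_adherent_UNIV:
  fixes p :: "('a::metric_space \<Rightarrow> complex) \<Rightarrow> complex"
  assumes p: "p \<in> characters (C_QG TYPE('a))"
  shows "adherent p UNIV"
  unfolding adherent_def
proof (intro allI impI, elim conjE)
  fix S :: "('a \<Rightarrow> complex) set" and \<epsilon> :: real
  assume S: "finite S" "S \<subseteq> C_QG TYPE('a)" and \<epsilon>: "\<epsilon> > 0"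
  define F where "F T x = (\<Sum>f\<in>T. (f x - p f) * cnj (f x - p f))" for T x
  have F: "F T \<in> C_QG TYPE('a) \<and> p (F T) = 0" if "finite T" "T \<subseteq> S" for T
    using that
  proof (induction T rule: finite_induct)
    case empty
    then show ?case
      using C_QG_const[of 0] character_const[OF p C_QG_const, of 0] by (simp add: F_def[abs_def])
  next
    case (insert f T)
    have f: "f \<in> C_QG TYPE('a)" using insert S(2) by blast
    let ?g = "\<lambda>x. f x - p f"
    have g: "?g \<in> C_QG TYPE('a)" 
      using C_QG_add[OF f C_QG_const[of "- p f"]] by simp
    have "p ?g = 0"
      using character_add[OF p f C_QG_const, of "- p f"] character_const[OF p C_QG_const, of "- p f"]
      by simp
    then have pg: "p (\<lambda>x. ?g x * cnj (?g x)) = 0"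
      using character_mult[OF p g C_QG_cnj[OF g]] by simp
    have gg: "(\<lambda>x. ?g x * cnj (?g x)) \<in> C_QG TYPE('a)"
      by (rule C_QG_mult[OF g C_QG_cnj[OF g]])
    have eq: "F (insert f T) = (\<lambda>x. ?g x * cnj (?g x) + F T x)"
      using insert by (simp add: F_def fun_eq_iff)
    have T: "F T \<in> C_QG TYPE('a)" "p (F T) = 0"
      using insert by auto
    show ?case
      unfolding eq using C_QG_add[OF gg T(1)] character_add[OF p gg T(1)] pg T(2) by simp
  qed
  have FS: "F S x = of_real (\<Sum>f\<in>S. (cmod (f x - p f))\<^sup>2)" for x
    unfolding F_def of_real_sum by (intro sum.cong refl) (simp only: complex_norm_square)
  show "\<exists>x\<in>UNIV. \<forall>f\<in>S. dist (f x) (p f) < \<epsilon>"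
  proof (rule ccontr)
    assume contra: "\<not> ?thesis"
    have "\<epsilon>\<^sup>2 \<le> cmod (F S x)" for x
    proof -
      obtain f where f: "f \<in> S" "\<epsilon> \<le> cmod (f x - p f)"
        using contra by (auto simp: dist_norm not_less)
      have "\<epsilon>\<^sup>2 \<le> (cmod (f x - p f))\<^sup>2"
        using f(2) \<epsilon> by (intro power_mono) auto
      also have "\<dots> \<le> (\<Sum>f\<in>S. (cmod (f x - p f))\<^sup>2)"
        using f(1) S(1) by (intro member_le_sum) auto
      also have "\<dots> \<le> cmod (F S x)"
        unfolding FS by (simp only: norm_of_real abs_ge_self)
      finally show ?thesis .
    qed
    moreover have pos: "\<epsilon>\<^sup>2 > 0" using \<epsilon> by simp
    ultimately have inv: "(\<lambda>x. inverse (F S x)) \<in> C_QG TYPE('a)" and nz: "F S x \<noteq> 0" for x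
      using C_QG_inverse F[OF S(1)] by (blast, metis not_less norm_zero)
    have "p (\<lambda>x. F S x * inverse (F S x)) = 0"
      using character_mult[OF p _ inv] F[OF S(1)] by simp
    moreover have "(\<lambda>x. F S x * inverse (F S x)) = (\<lambda>_. 1)"
      using nz by simp
    ultimately show False
      using character_one[OF p C_QG_const] by simp
  qed
qed

lemma compact_X_QG: "compact_space (X_QG TYPE('a::metric_space))"
proof -
  have "\<exists>b. \<forall>\<phi>\<in>characters (C_QG TYPE('a)). cmod (\<phi> f) \<le> b" if f: "f \<in> C_QG TYPE('a)" for f
  proof -
    obtain b where b: "\<And>x. cmod (f x) \<le> b"
      using C_QG_bounded_image[OF f, of UNIV] unfolding bounded_iff by blast
    have "cmod (\<phi> f) \<le> b + 1" if \<phi>: "\<phi> \<in> characters (C_QG TYPE('a))" for \<phi>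
    proof -
      obtain x where "dist (f x) (\<phi> f) < 1"
        using adherentE[OF character_adherent_UNIV[OF \<phi>] f zero_less_one] by blast
      with b[of x] show ?thesis
        using norm_triangle_ineq2[of "\<phi> f" "f x"] by (simp add: dist_norm norm_minus_commute)
    qed
    then show ?thesis by blast
  qed
  then obtain b where "\<And>\<phi> f. \<lbrakk>\<phi> \<in> characters (C_QG TYPE('a)); f \<in> C_QG TYPE('a)\<rbrakk> \<Longrightarrow> cmod (\<phi> f) \<le> b f"
    by metis
  then show ?thesis
    unfolding X_QG_def
    by (intro compact_maximal_ideal_space[of "C_QG TYPE('a)" b] C_QG_const C_QG_add C_QG_mult)
qed


section \<open>Points at infinity\<close>

lemma to_X_QG_in_characters:
  fixes x :: "'a::metric_space"
  shows "to_X_QG x \<in> characters (C_QG TYPE('a))"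
proof -
  have scale: "(\<lambda>y. c * f y) \<in> C_QG TYPE('a)" if "f \<in> C_QG TYPE('a)" for c f
    using C_QG_mult[OF C_QG_const that] .
  have "\<exists>f\<in>C_QG TYPE('a). to_X_QG x f \<noteq> 0"
    by (rule bexI[OF _ C_QG_const[of 1]]) (simp add: to_X_QG_def C_QG_const)
  then show ?thesis
    unfolding characters_def by (simp add: to_X_QG_def C_QG_add C_QG_mult scale)
qed

lemma limit_in_X_QG_iff:
  fixes g :: "nat \<Rightarrow> 'a::metric_space"
  shows "limit_in_X_QG g p \<longleftrightarrow>
    p \<in> characters (C_QG TYPE('a)) \<and> (\<forall>f\<in>C_QG TYPE('a). (\<lambda>n. f (g n)) \<longlonglongrightarrow> p f)"
  unfolding limit_in_X_QG_def X_QG_def limitin_maximal_ideal_space[OF to_X_QG_in_characters]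
  by (simp add: to_X_QG_def)

text \<open>
  A bump is bounded away from zero on smaller concentric balls, so these are the characters to
  which no bounded set is adherent. In terms of bumps it is plain that they form a closed set.
\<close>

definition points_at_infinity :: "'a::metric_space itself \<Rightarrow> (('a \<Rightarrow> complex) \<Rightarrow> complex) set" where
  "points_at_infinity T = {p \<in> characters (C_QG T). \<forall>t r. p (bump t r) = 0}"

lemma closedin_points_at_infinity:
  "closedin (X_QG TYPE('a)) (points_at_infinity TYPE('a::metric_space))"
proof -
  have "closedin (X_QG TYPE('a)) {p \<in> topspace (X_QG TYPE('a)). \<forall>t\<in>UNIV. \<forall>r\<in>UNIV. p (bump t r) = 0}"
    unfolding X_QG_def
    by (intro closedin_Collect_ball closedin_continuous_maps_eq[OF Hausdorff_space_euclidean]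
        continuous_map_character_eval bump_in_C_QG) simp
  then show ?thesis
    by (simp add: points_at_infinity_def X_QG_def)
qed

lemma not_adherent_bounded:
  fixes B :: "'a::metric_space set"
  assumes p: "p \<in> points_at_infinity TYPE('a)" and B: "bounded B"
  shows "\<not> adherent p B"
proof
  assume "adherent p B"
  obtain t e where t: "\<And>x. x \<in> B \<Longrightarrow> dist t x \<le> e"
    using B unfolding bounded_def by blast
  obtain x where x: "x \<in> B" "dist (bump t (e + 1) x) (p (bump t (e + 1))) < 1"
    using adherentE[OF \<open>adherent p B\<close> bump_in_C_QG zero_less_one] by blast
  have "p (bump t (e + 1)) = 0"
    using p by (simp add: points_at_infinity_def)
  then have "cmod (bump t (e + 1) x) < 1"
    using x(2) by simp
  moreover have "cmod (bump t (e + 1) x) \<ge> 1"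
    using t[OF x(1)] unfolding bump_def norm_of_real by simp
  ultimately show False by simp
qed

lemma adherent_ball_if_not_at_infinity:
  fixes p :: "('a::metric_space \<Rightarrow> complex) \<Rightarrow> complex"
  assumes p: "p \<in> characters (C_QG TYPE('a))" "p \<notin> points_at_infinity TYPE('a)"
  shows "\<exists>t r. adherent p (ball t r)"
proof -
  obtain t r where tr: "p (bump t r) \<noteq> 0"
    using p unfolding points_at_infinity_def by blast
  have "\<not> adherent p (- ball t r)"
  proof
    assume "adherent p (- ball t r)"
    then obtain x where x: "x \<in> - ball t r" "dist (bump t r x) (p (bump t r)) < cmod (p (bump t r))"
      using adherentE[OF _ bump_in_C_QG, of p "- ball t r" "cmod (p (bump t r))" t r] tr by auto
    then have "bump t r x = 0" by (simp add: bump_eq_0_iff)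
    with x(2) show False by simp
  qed
  moreover have "adherent p (ball t r \<union> - ball t r)"
    using character_adherent_UNIV[OF p(1)] by simp
  ultimately show ?thesis
    using adherent_UnD by blast
qed

text \<open>
  A compact set is closed in the compactification: if \<open>p\<close> differs from the evaluation at \<open>x\<close>, one
  function keeps a whole neighbourhood of \<open>x\<close> away from \<open>p\<close>, and finitely many such
  neighbourhoods cover the set.
\<close>

lemma adherent_compact_imp_evaluation:
  fixes p :: "('a::metric_space \<Rightarrow> complex) \<Rightarrow> complex"
  assumes p: "p \<in> characters (C_QG TYPE('a))" and B: "compact B" "adherent p B"
  shows "p \<in> range to_X_QG"
proof (rule ccontr)
  assume "p \<notin> range to_X_QG"
  have "\<exists>f. f \<in> C_QG TYPE('a) \<and> f x \<noteq> p f" for x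
  proof (rule ccontr)
    assume "\<not> ?thesis"
    then have "to_X_QG x f = p f" if "f \<in> C_QG TYPE('a)" for f
      using that by (auto simp: to_X_QG_def)
    then have "to_X_QG x = p"
      by (rule character_eqI[OF to_X_QG_in_characters p])
    with \<open>p \<notin> range to_X_QG\<close> show False by blast
  qed
  then obtain f where f: "\<And>x. f x \<in> C_QG TYPE('a)" "\<And>x. f x x \<noteq> p (f x)"
    by metis
  define V where "V x = {y. dist (f x x) (p (f x)) / 2 < dist (f x y) (p (f x))}" for x
  have "open (V x)" for x
    unfolding V_def using C_QG_continuous[OF f(1)[of x]]
    by (intro open_Collect_less continuous_intros) auto
  moreover have "B \<subseteq> (\<Union>x\<in>B. V x)"
    using f(2) by (auto simp: V_def)
  ultimately obtain C where C: "C \<subseteq> B" "finite C" "B \<subseteq> (\<Union>x\<in>C. V x)"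
    using compactE_image[OF B(1), of B V] by metis
  obtain x where "adherent p (V x)"
    using adherent_UN_D[OF C(2) adherent_mono[OF B(2) C(3)]] by blast
  then obtain y where "y \<in> V x" "dist (f x y) (p (f x)) < dist (f x x) (p (f x)) / 2"
    using adherentE[OF _ f(1)[of x], of p "V x" "dist (f x x) (p (f x)) / 2"] f(2)[of x] by auto
  then show False by (simp add: V_def)
qed

lemma boundary_proper:
  assumes "proper_space TYPE('a::metric_space)"
  shows "topspace (X_QG TYPE('a)) - range to_X_QG = points_at_infinity TYPE('a)"
proof (intro equalityI subsetI)
  fix p assume p: "p \<in> topspace (X_QG TYPE('a)) - range to_X_QG"
  then have ch: "p \<in> characters (C_QG TYPE('a))" by (simp add: X_QG_def)
  show "p \<in> points_at_infinity TYPE('a)"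
  proof (rule ccontr)
    assume "p \<notin> points_at_infinity TYPE('a)"
    then obtain t r where "adherent p (ball t r)"
      using adherent_ball_if_not_at_infinity[OF ch] by blast
    then have "adherent p (cball t r)"
      by (rule adherent_mono) (rule ball_subset_cball)
    moreover have "compact (cball t r)"
      using assms unfolding proper_space_def by simp
    ultimately show False
      using adherent_compact_imp_evaluation[OF ch] p by blast
  qed
next
  fix p assume p: "p \<in> points_at_infinity TYPE('a)"
  have "p \<noteq> to_X_QG x" for x
  proof
    assume "p = to_X_QG x"
    then have "p (bump x 1) = 1"
      using bump_in_C_QG[of x 1] by (simp add: to_X_QG_def bump_def)
    then show False using p by (simp add: points_at_infinity_def)
  qed
  then show "p \<in> topspace (X_QG TYPE('a)) - range to_X_QG"
    using p by (auto simp: points_at_infinity_def X_QG_def)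
qed

text \<open>
  For spaces that are not proper, the boundary consists of limits of rays with arbitrary constants.
  They lie at infinity because a ray leaves every ball for good.
\<close>

lemma ray_limit_at_infinity:
  fixes g :: "nat \<Rightarrow> 'a::metric_space"
  assumes g: "integral_quasi_geodesic_ray q Q g" and lim: "limit_in_X_QG g p"
  shows "p \<in> points_at_infinity TYPE('a)"
proof -
  have "p (bump t r) = 0" for t r
  proof -
    have q: "q \<ge> 1"
      using g by (simp add: integral_quasi_geodesic_ray_def integral_quasi_geodesic_def)
    obtain N where N: "(r + dist t (g 1) + Q) * q + 1 \<le> real N"
      using real_arch_simple by blast
    have "bump t r (g n) = 0" if "n \<ge> max 1 N" for n
    proof -
      have "1 \<in> {1::nat..}" "n \<in> {1..}" using that by simp_all
      then have "\<bar>real 1 - real n\<bar> / q - Q \<le> dist (g 1) (g n)"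
        using g unfolding integral_quasi_geodesic_ray_def integral_quasi_geodesic_def by blast
      moreover have "r + dist t (g 1) + Q \<le> \<bar>real 1 - real n\<bar> / q"
        using N that q by (simp add: pos_le_divide_eq)
      ultimately have "r + dist t (g 1) \<le> dist (g 1) (g n)" by linarith
      then show ?thesis
        using dist_triangle[of "g 1" "g n" t] by (simp add: bump_eq_0_iff dist_commute)
    qed
    then have "(\<lambda>n. bump t r (g n)) \<longlonglongrightarrow> 0"
      by (intro tendsto_eventually eventually_sequentiallyI)
    moreover have "(\<lambda>n. bump t r (g n)) \<longlonglongrightarrow> p (bump t r)"
      using lim bump_in_C_QG unfolding limit_in_X_QG_iff by blast
    ultimately show ?thesis
      using LIMSEQ_unique by blast
  qed
  then show ?thesis
    using lim by (simp add: points_at_infinity_def limit_in_X_QG_iff)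
qed

section \<open>Rays converging to points at infinity\<close>

text \<open>
  The tail of a ray lies in its cones, on which \<open>f\<close> is nearly constant; by adherence the constant
  is nearly \<open>p f\<close>.
\<close>

lemma adherent_cones_imp_limit:
  fixes g :: "nat \<Rightarrow> 'a::metric_space"
  assumes g: "integral_quasi_geodesic_ray k k g" and p: "p \<in> characters (C_QG TYPE('a))"
    and ad: "\<And>m. adherent p (cone (g 1) k k g m)"
  shows "limit_in_X_QG g p"
  unfolding limit_in_X_QG_iff
proof (intro conjI ballI p metric_LIMSEQ_I)
  fix f :: "'a \<Rightarrow> complex" and \<epsilon> :: real
  assume f: "f \<in> C_QG TYPE('a)" and "\<epsilon> > 0"
  then have \<epsilon>: "\<epsilon> / 2 > 0" by simp
  obtain m where m: "m \<ge> 1"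
    "\<forall>x\<in>cone (g 1) k k g m. \<forall>y\<in>cone (g 1) k k g m. dist (f x) (f y) < \<epsilon> / 2"
    using C_QG_small_on_cone[OF f \<epsilon> g] by blast
  obtain x where x: "x \<in> cone (g 1) k k g m" "dist (f x) (p f) < \<epsilon> / 2"
    by (rule adherentE[OF ad f \<epsilon>])
  have "dist (f (g n)) (p f) < \<epsilon>" if "n \<ge> m" for n
  proof -
    have "dist (f (g n)) (f x) < \<epsilon> / 2"
      using m(2) x(1) ray_in_cone[OF g m(1) that] by blast
    with x(2) show ?thesis
      using dist_triangle[of "f (g n)" "p f" "f x"] by linarith
  qed
  then show "\<exists>N. \<forall>n\<ge>N. dist (f (g n)) (p f) < \<epsilon>" by blast
qed

lemma integral_interval_atLeastAtMost: "integral_interval {1..n}"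
  unfolding integral_interval_def
  by (rule exI[of _ 0], rule exI[of _ "ereal (real n + 1)"]) auto

lemma quasi_geodesic_rayI:
  assumes g: "\<And>n. integral_quasi_geodesic q Q {1..n} g"
  shows "integral_quasi_geodesic_ray q Q g"
  unfolding integral_quasi_geodesic_ray_def integral_quasi_geodesic_def
proof (intro conjI ballI)
  show "1 \<le> q" "0 \<le> Q" using g[of 1] by (simp_all add: integral_quasi_geodesic_def)
  show "integral_interval {1..}"
    unfolding integral_interval_def by (rule exI[of _ 0], rule exI[of _ "\<infinity>"]) auto
  fix i j :: nat assume "i \<in> {1..}" "j \<in> {1..}"
  then have "i \<in> {1..max i j}" "j \<in> {1..max i j}" by simp_all
  then show "\<bar>real i - real j\<bar> / q - Q \<le> dist (g i) (g j)"
      "dist (g i) (g j) \<le> q * \<bar>real i - real j\<bar> + Q"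
    using g[of "max i j"] unfolding integral_quasi_geodesic_def by blast+
qed

lemma quasi_geodesic_perturb:
  assumes h: "integral_quasi_geodesic k k D h" and "M > 0"
    and close: "\<And>i. i \<in> D \<Longrightarrow> dist (h i) (g i) < M"
  shows "integral_quasi_geodesic (k + 2 * M) (k + 2 * M) D g"
proof -
  have k: "k \<ge> 1" using h by (simp add: integral_quasi_geodesic_def)
  have "\<bar>real i - real j\<bar> / (k + 2 * M) - (k + 2 * M) \<le> dist (g i) (g j) \<and>
        dist (g i) (g j) \<le> (k + 2 * M) * \<bar>real i - real j\<bar> + (k + 2 * M)"
    if ij: "i \<in> D" "j \<in> D" for i j
  proof -
    have hij: "\<bar>real i - real j\<bar> / k - k \<le> dist (h i) (h j)"
        "dist (h i) (h j) \<le> k * \<bar>real i - real j\<bar> + k"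
      using h ij by (auto simp: integral_quasi_geodesic_def)
    have "dist (g i) (g j) \<le> dist (h i) (h j) + 2 * M" "dist (h i) (h j) \<le> dist (g i) (g j) + 2 * M"
      using close[OF ij(1)] close[OF ij(2)]
        dist_triangle[of "g i" "g j" "h i"] dist_triangle[of "h i" "g j" "h j"]
        dist_triangle[of "h i" "h j" "g i"] dist_triangle[of "g i" "h j" "g j"]
      by (simp_all add: dist_commute)
    moreover have "\<bar>real i - real j\<bar> / (k + 2 * M) \<le> \<bar>real i - real j\<bar> / k"
      using k \<open>M > 0\<close> by (intro divide_left_mono) auto
    moreover have "k * \<bar>real i - real j\<bar> \<le> (k + 2 * M) * \<bar>real i - real j\<bar>"
      using \<open>M > 0\<close> by (intro mult_right_mono) auto
    ultimately show ?thesis using hij by linarith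
  qed
  with h k \<open>M > 0\<close> show ?thesis
    by (simp add: integral_quasi_geodesic_def)
qed

lemma quasi_geodesic_from_base:
  fixes x0 :: "'a::metric_space"
  assumes "integrally_quasi_geodesic_space TYPE('a) k k"
  shows "\<exists>(h :: nat \<Rightarrow> 'a) n. 1 \<le> n \<and> integral_quasi_geodesic k k {1..n} h \<and> h 1 = x0 \<and> h n = x"
proof -
  obtain g i j where g: "1 \<le> i" "i \<le> j" "integral_quasi_geodesic k k {i..j} g" "g i = x0" "g j = x"
    using assms unfolding integrally_quasi_geodesic_space_def by blast
  \<comment> \<open>Shift time so that the path starts at \<open>1\<close> instead of \<open>i\<close>.\<close>
  define h where "h l = g (l + i - 1)" for l
  have "integral_quasi_geodesic k k {1..j - i + 1} h"
    unfolding integral_quasi_geodesic_def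
  proof (intro conjI ballI)
    show "1 \<le> k" "0 \<le> k" using g(3) by (auto simp: integral_quasi_geodesic_def)
    show "integral_interval {1..j - i + 1}" by (rule integral_interval_atLeastAtMost)
    fix a b assume ab: "a \<in> {1..j - i + 1}" "b \<in> {1..j - i + 1}"
    then have mem: "a + i - 1 \<in> {i..j}" "b + i - 1 \<in> {i..j}" using g(2) by auto
    have "real (a + i - 1) - real (b + i - 1) = real a - real b"
      using g(1) by (simp add: of_nat_diff)
    with g(3) mem show "\<bar>real a - real b\<bar> / k - k \<le> dist (h a) (h b)"
        "dist (h a) (h b) \<le> k * \<bar>real a - real b\<bar> + k"
      unfolding integral_quasi_geodesic_def h_def by metis+
  qed
  moreover have "h 1 = x0" "h (j - i + 1) = x" "1 \<le> j - i + 1"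
    using g by (auto simp: h_def)
  ultimately show ?thesis by blast
qed

text \<open>
  Koenig's lemma with "infinite" replaced by "adherent to \<open>p\<close>": when a set adherent to \<open>p\<close> is
  split into finitely many pieces, one of the pieces is adherent to \<open>p\<close>.
\<close>

lemma Koenig_adherent:
  fixes c :: "nat \<Rightarrow> 'a::metric_space \<Rightarrow> 'b"
  assumes p: "adherent p UNIV" and F: "\<And>n. finite (F n)" "\<And>n x. c n x \<in> F n"
  obtains g where "\<And>n. g n \<in> F n" "\<And>n. adherent p {x. \<forall>i<n. c i x = g i}"
proof -
  have "\<exists>s. \<forall>n. adherent p {x. \<forall>i<n. c i x = s n i} \<and>
      (s (Suc n) n \<in> F n \<and> (\<forall>i<n. s (Suc n) i = s n i))"
  proof (rule dependent_nat_choice)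
    show "\<exists>s. adherent p {x. \<forall>i<0. c i x = s i}" using p by simp
    fix s n
    assume s: "adherent p {x. \<forall>i<n. c i x = s i}"
    have "{x. \<forall>i<n. c i x = s i} \<subseteq> (\<Union>y\<in>F n. {x. \<forall>i<Suc n. c i x = (s(n := y)) i})"
      using F(2) by (auto simp: less_Suc_eq)
    then obtain y where "y \<in> F n" "adherent p {x. \<forall>i<Suc n. c i x = (s(n := y)) i}"
      using adherent_UN_D[OF F(1) adherent_mono[OF s]] by blast
    then show "\<exists>s'. adherent p {x. \<forall>i<Suc n. c i x = s' i} \<and> (s' n \<in> F n \<and> (\<forall>i<n. s' i = s i))"
      by (intro exI[of _ "s(n := y)"]) simp
  qed
  then obtain s where s: "\<And>n. adherent p {x. \<forall>i<n. c i x = s n i}"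
      "\<And>n. s (Suc n) n \<in> F n" "\<And>n i. i < n \<Longrightarrow> s (Suc n) i = s n i"
    by blast
  define g where "g n = s (Suc n) n" for n
  have "s n i = g i" if "i < n" for n i
    using that by (induction n) (auto simp: less_Suc_eq g_def s(3))
  then have "{x. \<forall>i<n. c i x = s n i} = {x. \<forall>i<n. c i x = g i}" for n
    by auto
  then show ?thesis
    using that[of g] s(1,2) by (simp add: g_def)
qed


text \<open>
  The code of \<open>x\<close> is its path from \<open>x0\<close> rounded to the nets \<open>F i\<close>, and \<open>g\<close> is a sequence all of whose
  initial pieces are shared by the codes of a set adherent to \<open>p\<close>. Restricting the rays to the nets
  matters for metrizability, where countably many cones have to serve all points at infinity.
\<close>

lemma point_at_infinity_is_limit_of_net_ray:
  fixes x0 :: "'a::metric_space" and F :: "nat \<Rightarrow> 'a set"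
  assumes k: "k \<ge> 1" and M: "M > 0"
    and F: "\<And>i. finite (F i)" "\<And>i. x0 \<in> F i"
    and net: "\<And>i x. dist x0 x \<le> k * real i + k \<Longrightarrow> \<exists>y\<in>F i. dist x y < M"
    and X: "integrally_quasi_geodesic_space TYPE('a) k k"
    and p: "p \<in> points_at_infinity TYPE('a)"
  shows "\<exists>g. (\<forall>i. g i \<in> F i) \<and> g 1 = x0 \<and>
    integral_quasi_geodesic_ray (k + 2 * M) (k + 2 * M) g \<and>
    (\<forall>m. adherent p (cone x0 (k + 2 * M) (k + 2 * M) g m))"
proof -
  obtain h n where n: "\<And>x. 1 \<le> n x" and h: "\<And>x. integral_quasi_geodesic k k {1..n x} (h x)"
    and h1: "\<And>x. h x 1 = x0" and hn: "\<And>x. h x (n x) = x"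
    using quasi_geodesic_from_base[OF X, of x0] by metis
  have h_dist: "dist x0 (h x i) \<le> k * real i + k" if "i \<in> {1..n x}" for x i
  proof -
    have "1 \<in> {1..n x}" using n by simp
    then have "dist (h x 1) (h x i) \<le> k * \<bar>real 1 - real i\<bar> + k"
      using h[of x] that unfolding integral_quasi_geodesic_def by blast
    moreover have "k * \<bar>real 1 - real i\<bar> \<le> k * real i"
      using k that by (intro mult_left_mono) auto
    ultimately show ?thesis using h1 by simp
  qed
  \<comment> \<open>Where the path to \<open>x\<close> is already over, the code takes the default value \<open>x0\<close>.\<close>
  have "\<exists>y\<in>F i. (i = 1 \<longrightarrow> y = x0) \<and> (i \<in> {1..n x} \<longrightarrow> dist (h x i) y < M)" for i x
  proof (cases "i = 1 \<or> i \<notin> {1..n x}")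
    case True
    then show ?thesis using F(2) h1 M by (intro bexI[of _ x0]) auto
  next
    case False
    then show ?thesis using net[OF h_dist, of i x] by blast
  qed
  then obtain c where c: "\<And>i x. c i x \<in> F i" "\<And>x. c 1 x = x0"
      "\<And>i x. i \<in> {1..n x} \<Longrightarrow> dist (h x i) (c i x) < M"
    by metis
  have "adherent p UNIV"
    using p character_adherent_UNIV unfolding points_at_infinity_def by blast
  from Koenig_adherent[where c = c and F = F, OF this F(1) c(1)]
  obtain g where g: "\<And>i. g i \<in> F i" "\<And>m. adherent p {x. \<forall>i<m. c i x = g i}"
    by metis
  \<comment> \<open>Discarding the paths that end before time \<open>m\<close> removes a bounded set only.\<close>
  define A where "A m = {x. (\<forall>i<m. c i x = g i) \<and> m \<le> n x}" for m
  have adA: "adherent p (A m)" for m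
  proof -
    have far: "dist x0 x \<le> k * real m + k" if "\<not> m \<le> n x" for x
    proof -
      have "dist x0 (h x (n x)) \<le> k * real (n x) + k"
        using n by (intro h_dist) simp
      also have "\<dots> \<le> k * real m + k"
        using that k by (intro add_right_mono mult_left_mono) auto
      finally show ?thesis by (simp only: hn)
    qed
    have sub: "{x. \<forall>i<m. c i x = g i} \<subseteq> A m \<union> cball x0 (k * real m + k)"
    proof
      fix x assume "x \<in> {x. \<forall>i<m. c i x = g i}"
      then show "x \<in> A m \<union> cball x0 (k * real m + k)"
        using far[of x] by (cases "m \<le> n x") (simp_all add: A_def)
    qed
    have "adherent p (A m \<union> cball x0 (k * real m + k))"
      by (rule adherent_mono[OF g(2) sub])
    with not_adherent_bounded[OF p bounded_cball] show ?thesis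
      using adherent_UnD by blast
  qed
  have follows: "i \<in> {1..n x} \<and> dist (h x i) (g i) < M"
    if "x \<in> A m" "1 \<le> i" "i < m" for x m i
  proof -
    have "c i x = g i" "i \<in> {1..n x}" using that by (auto simp: A_def)
    then show ?thesis using c(3)[of i x] by simp
  qed
  have "\<exists>x. x \<in> A m" for m using adA[of m] not_adherent_empty[of p] by (cases "A m = {}") auto
  then obtain a where a: "\<And>m. a m \<in> A m" by metis
  have g1: "g 1 = x0"
    using a[of 2] c(2)[of "a 2"] by (simp add: A_def)
  have ray: "integral_quasi_geodesic_ray (k + 2 * M) (k + 2 * M) g"
  proof (rule quasi_geodesic_rayI)
    fix N
    have "N \<le> n (a (Suc N))" using a[of "Suc N"] by (simp add: A_def)
    then have "integral_quasi_geodesic k k {1..N} (h (a (Suc N)))"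
      using h[of "a (Suc N)"] integral_interval_atLeastAtMost[of N]
      by (simp add: integral_quasi_geodesic_def)
    then show "integral_quasi_geodesic (k + 2 * M) (k + 2 * M) {1..N} g"
      by (rule quasi_geodesic_perturb[OF _ M]) (use follows[OF a] in auto)
  qed
  have "A (Suc m) \<subseteq> cone x0 (k + 2 * M) (k + 2 * M) g m" for m
  proof
    fix x assume x: "x \<in> A (Suc m)"
    \<comment> \<open>Follow \<open>g\<close> up to time \<open>m\<close>, then the path to \<open>x\<close>. As \<open>x\<close> lies in \<open>A (Suc m)\<close>, this path is
        still running after time \<open>m\<close>, so the combined path ends at \<open>x\<close>.\<close>
    define h' where "h' i = (if i \<le> m then g i else h x i)" for i
    have "dist (h x i) (h' i) < M" if "i \<in> {1..n x}" for i
      using follows[OF x, of i] that M by (auto simp: h'_def)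
    then have "integral_quasi_geodesic (k + 2 * M) (k + 2 * M) {1..n x} h'"
      by (rule quasi_geodesic_perturb[OF h M])
    moreover have "m < n x" using x by (simp add: A_def)
    ultimately show "x \<in> cone x0 (k + 2 * M) (k + 2 * M) g m"
      unfolding cone_def using n[of x] g1 h1[of x] hn[of x]
      by (intro CollectI exI[of _ "{1..n x}"] exI[of _ h'] exI[of _ "n x"]) (simp add: h'_def)
  qed
  then have "adherent p (cone x0 (k + 2 * M) (k + 2 * M) g m)" for m
    using adA adherent_mono by blast
  with g(1) g1 ray show ?thesis by blast
qed

section \<open>Countable separating families\<close>

text \<open>
  A cone depends only on the initial piece \<open>g 1, \<dots>, g m\<close>.
\<close>

lemma countable_cones:
  assumes "\<And>i. finite (F i)"
  shows "countable {cone x0 q Q g m | g m. \<forall>i. g i \<in> F i}"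
proof -
  have prefix: "cone x0 q Q g m \<in> (\<lambda>g. cone x0 q Q g m) ` (\<Pi>\<^sub>E i\<in>{1..m}. F i)" if "\<forall>i. g i \<in> F i" for g m
  proof
    show "cone x0 q Q g m = cone x0 q Q (restrict g {1..m}) m"
      unfolding cone_def by simp
    show "restrict g {1..m} \<in> (\<Pi>\<^sub>E i\<in>{1..m}. F i)"
      using that by simp
  qed
  have "{cone x0 q Q g m | g m. \<forall>i. g i \<in> F i}
      \<subseteq> (\<Union>m. (\<lambda>g. cone x0 q Q g m) ` (\<Pi>\<^sub>E i\<in>{1..m}. F i))"
  proof
    fix C assume "C \<in> {cone x0 q Q g m | g m. \<forall>i. g i \<in> F i}"
    then obtain g m where "C = cone x0 q Q g m" "\<forall>i. g i \<in> F i" by auto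
    then show "C \<in> (\<Union>m. (\<lambda>g. cone x0 q Q g m) ` (\<Pi>\<^sub>E i\<in>{1..m}. F i))"
      using prefix[of g m] by (intro UN_I[of m]) simp_all
  qed
  moreover have "countable (\<Union>m. (\<lambda>g. cone x0 q Q g m) ` (\<Pi>\<^sub>E i\<in>{1..m}. F i))"
    using assms by (intro countable_UN countable_image countable_PiE) (auto intro: countable_finite)
  ultimately show ?thesis
    by (rule countable_subset)
qed

lemma adherent_in_closure:
  fixes f :: "'a::metric_space \<Rightarrow> complex"
  assumes "adherent p C" "f \<in> C_QG TYPE('a)"
  shows "p f \<in> closure (f ` C)"
  unfolding closure_approachable
proof (intro allI impI)
  fix e :: real assume "e > 0"
  from adherentE[OF assms this] show "\<exists>y\<in>f ` C. dist y (p f) < e" by blast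
qed

lemma closure_image_near_character:
  fixes f :: "'a::metric_space \<Rightarrow> complex"
  assumes ad: "adherent p C" and f: "f \<in> C_QG TYPE('a)"
    and small: "\<And>x y. \<lbrakk>x \<in> C; y \<in> C\<rbrakk> \<Longrightarrow> dist (f x) (f y) < \<delta>"
  shows "closure (f ` C) \<subseteq> cball (p f) \<delta>"
proof (rule closure_minimal)
  show "f ` C \<subseteq> cball (p f) \<delta>"
  proof (rule image_subsetI)
    fix x assume x: "x \<in> C"
    have "dist (p f) (f x) \<le> \<delta> + e" if e: "e > 0" for e
    proof -
      obtain y where "y \<in> C" "dist (f y) (p f) < e" by (rule adherentE[OF ad f e])
      with small[OF x, of y] show ?thesis
        using dist_triangle[of "p f" "f x" "f y"] by (simp add: dist_commute)
    qed
    then have "dist (p f) (f x) \<le> \<delta>" by (rule field_le_epsilon)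
    then show "f x \<in> cball (p f) \<delta>" by simp
  qed
qed simp

text \<open>
  Two characters that differ are adherent to two members of the family on which some function of
  the algebra takes values far apart. Hence it is enough to choose one such function for each pair
  of members that admits one.
\<close>

lemma countable_separating_family:
  fixes \<C> :: "'a::metric_space set set"
  assumes \<C>: "countable \<C>"
    and small: "\<And>p f \<epsilon>. \<lbrakk>p \<in> K; f \<in> C_QG TYPE('a); \<epsilon> > 0\<rbrakk>
      \<Longrightarrow> \<exists>C\<in>\<C>. adherent p C \<and> (\<forall>x\<in>C. \<forall>y\<in>C. dist (f x) (f y) < \<epsilon>)"
    and K: "K \<subseteq> characters (C_QG TYPE('a))"
  shows "\<exists>S. countable S \<and> S \<subseteq> C_QG TYPE('a) \<and> (\<forall>p\<in>K. \<forall>q\<in>K. p \<noteq> q \<longrightarrow> (\<exists>f\<in>S. p f \<noteq> q f))"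
proof -
  define separates where "separates = (\<lambda>f C D. f \<in> C_QG TYPE('a) \<and> closure (f ` C) \<inter> closure (f ` D) = {})"
  define Z where "Z = {(C, D) \<in> \<C> \<times> \<C>. \<exists>f. separates f C D}"
  define e where "e = (\<lambda>(C, D). SOME f. separates f C D)"
  have e: "separates (e (C, D)) C D" if "(C, D) \<in> Z" for C D
    using that someI_ex[of "\<lambda>f. separates f C D"] by (simp add: Z_def e_def)
  have "Z \<subseteq> \<C> \<times> \<C>" by (auto simp: Z_def)
  then have "countable Z"
    using countable_SIGMA[OF \<C> \<C>] by (rule countable_subset)
  then have "countable (e ` Z)" by (rule countable_image)
  moreover have "e ` Z \<subseteq> C_QG TYPE('a)"
    using e by (auto simp: separates_def)
  moreover have "\<exists>f\<in>e ` Z. p f \<noteq> q f" if pq: "p \<in> K" "q \<in> K" "p \<noteq> q" for p q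
  proof -
    obtain f where f: "f \<in> C_QG TYPE('a)" "p f \<noteq> q f"
      using character_eqI[of p "C_QG TYPE('a)" q] pq K by blast
    \<comment> \<open>Closed discs of radius \<open>\<delta>\<close> around \<open>p f\<close> and \<open>q f\<close> are disjoint.\<close>
    define \<delta> where "\<delta> = dist (p f) (q f) / 3"
    have \<delta>: "\<delta> > 0" using f(2) by (simp add: \<delta>_def)
    obtain C where C: "C \<in> \<C>" "adherent p C" "\<forall>x\<in>C. \<forall>y\<in>C. dist (f x) (f y) < \<delta>"
      using small[OF pq(1) f(1) \<delta>] by blast
    obtain D where D: "D \<in> \<C>" "adherent q D" "\<forall>x\<in>D. \<forall>y\<in>D. dist (f x) (f y) < \<delta>"
      using small[OF pq(2) f(1) \<delta>] by blast
    have "closure (f ` C) \<subseteq> cball (p f) \<delta>" "closure (f ` D) \<subseteq> cball (q f) \<delta>"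
      using closure_image_near_character[OF C(2) f(1)] C(3)
        closure_image_near_character[OF D(2) f(1)] D(3) by blast+
    moreover have "cball (p f) \<delta> \<inter> cball (q f) \<delta> = {}"
      using \<delta> by (intro disjoint_cballI) (simp add: \<delta>_def)
    ultimately have "separates f C D"
      using f(1) unfolding separates_def by blast
    then have Z: "(C, D) \<in> Z"
      using C(1) D(1) by (auto simp: Z_def)
    have "e (C, D) \<in> C_QG TYPE('a)" "closure (e (C, D) ` C) \<inter> closure (e (C, D) ` D) = {}"
      using e[OF Z] by (simp_all add: separates_def)
    then have "p (e (C, D)) \<noteq> q (e (C, D))"
      using adherent_in_closure[OF C(2)] adherent_in_closure[OF D(2)] by (metis IntI empty_iff)
    with Z show ?thesis by blast
  qed
  ultimately show ?thesis by (intro exI[of _ "e ` Z"] conjI ballI impI)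
qed

lemma proper_space_countable_dense:
  assumes "proper_space TYPE('a::metric_space)"
  shows "\<exists>D :: 'a set. countable D \<and> (\<forall>x. \<forall>\<epsilon>>0. \<exists>t\<in>D. dist t x < \<epsilon>)"
proof -
  obtain a :: 'a where True by simp
  have "\<exists>T. finite T \<and> cball a (real n) \<subseteq> (\<Union>t\<in>T. ball t (1 / real (Suc m)))" for n m
  proof -
    have "compact (cball a (real n))"
      using assms unfolding proper_space_def by simp
    moreover have "cball a (real n) \<subseteq> (\<Union>t\<in>cball a (real n). ball t (1 / real (Suc m)))"
      by (intro subsetI UN_I centre_in_ball[THEN iffD2]) auto
    ultimately obtain T where "finite T" "cball a (real n) \<subseteq> (\<Union>t\<in>T. ball t (1 / real (Suc m)))"
      using compactE_image[of "cball a (real n)" "cball a (real n)" "\<lambda>t. ball t (1 / real (Suc m))"]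
      by (metis open_ball)
    then show ?thesis by blast
  qed
  then obtain T where T: "\<And>n m. finite (T n m)"
      "\<And>n m. cball a (real n) \<subseteq> (\<Union>t\<in>T n m. ball t (1 / real (Suc m)))"
    by metis
  have "\<exists>t\<in>(\<Union>n m. T n m). dist t x < \<epsilon>" if \<epsilon>: "\<epsilon> > 0" for x \<epsilon>
  proof -
    obtain n where "dist a x \<le> real n" using real_arch_simple by blast
    then have n: "x \<in> cball a (real n)" by simp
    obtain m where m: "1 / real (Suc m) < \<epsilon>" using nat_approx_posE[OF \<epsilon>] by blast
    obtain t where "t \<in> T n m" "x \<in> ball t (1 / real (Suc m))" using T(2) n by blast
    with m show ?thesis by (intro bexI[of _ t]) auto
  qed
  moreover have "countable (\<Union>n m. T n m)"
    using T(1) by (intro countable_UN) (auto intro: countable_finite)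
  ultimately show ?thesis by (intro exI[of _ "\<Union>n m. T n m"] conjI allI impI)
qed

text \<open>
  The family consists of the bumps of rational radius centred in a countable dense set.
\<close>

lemma countable_family_separating_points:
  assumes "proper_space TYPE('a::metric_space)"
  shows "\<exists>S. countable S \<and> S \<subseteq> C_QG TYPE('a) \<and>
    (\<forall>x :: 'a. \<forall>\<epsilon>>0. \<exists>f\<in>S. f x \<noteq> 0 \<and> (\<forall>y. \<epsilon> \<le> dist x y \<longrightarrow> f y = 0) \<and>
      (\<forall>q\<in>points_at_infinity TYPE('a). q f = 0))"
proof -
  obtain D :: "'a set" where D: "countable D" "\<And>x \<epsilon>. \<epsilon> > 0 \<Longrightarrow> \<exists>t\<in>D. dist t x < \<epsilon>"
    using proper_space_countable_dense[OF assms] by blast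
  define S where "S = (\<Union>t\<in>D. \<Union>r\<in>\<rat>. {bump t r})"
  have "\<exists>f\<in>S. f x \<noteq> 0 \<and> (\<forall>y. \<epsilon> \<le> dist x y \<longrightarrow> f y = 0) \<and> (\<forall>q\<in>points_at_infinity TYPE('a). q f = 0)"
    if \<epsilon>: "\<epsilon> > 0" for x \<epsilon>
  proof -
    have "0 < \<epsilon> / 2" using \<epsilon> by simp
    then obtain r where r: "r \<in> \<rat>" "0 < r" "r < \<epsilon> / 2"
      using Rats_dense_in_real by blast
    obtain t where t: "t \<in> D" "dist t x < r" using D(2)[OF r(2)] by blast
    have "bump t r y = 0" if "\<epsilon> \<le> dist x y" for y
      using that t(2) r(3) dist_triangle[of x y t] by (simp add: bump_eq_0_iff dist_commute)
    moreover have "bump t r x \<noteq> 0"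
      using t(2) by (simp add: bump_eq_0_iff)
    moreover have "bump t r \<in> S" using r(1) t(1) by (auto simp: S_def)
    ultimately show ?thesis
      by (intro bexI[of _ "bump t r"]) (auto simp: points_at_infinity_def)
  qed
  moreover have "countable S"
    unfolding S_def using D(1) countable_rat by (intro countable_UN) auto
  moreover have "S \<subseteq> C_QG TYPE('a)"
    using bump_in_C_QG by (auto simp: S_def)
  ultimately show ?thesis by (intro exI[of _ S] conjI allI impI)
qed


section \<open>Compactness, metrizability and limits of rays\<close>

lemma finite_net_if_finite_cover:
  fixes B :: "'a::metric_space set"
  assumes "\<exists>\<F>. finite \<F> \<and> B \<subseteq> \<Union>\<F> \<and> (\<forall>U\<in>\<F>. bounded U \<and> diameter U < M)"
  shows "\<exists>F. finite F \<and> (\<forall>x\<in>B. \<exists>y\<in>F. dist x y < M)"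
proof -
  obtain \<F> where \<F>: "finite \<F>" "B \<subseteq> \<Union>\<F>" "\<forall>U\<in>\<F>. bounded U \<and> diameter U < M"
    using assms by (elim exE conjE)
  let ?F = "(\<lambda>U. SOME y. y \<in> U) ` \<F>"
  have "\<exists>y\<in>?F. dist x y < M" if "x \<in> B" for x
  proof -
    obtain U where U: "U \<in> \<F>" "x \<in> U" using \<F>(2) \<open>x \<in> B\<close> by (auto dest: subsetD)
    then have "(SOME y. y \<in> U) \<in> U" by (metis someI)
    then have "dist x (SOME y. y \<in> U) \<le> diameter U"
      using \<F>(3) U by (intro diameter_bounded_bound) auto
    also have "\<dots> < M" using \<F>(3) U(1) by simp
    finally show ?thesis using U(1) by (intro bexI[OF _ imageI])
  qed
  with \<F>(1) show ?thesis by (intro exI[of _ ?F] conjI ballI) simp_all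
qed

lemma metrizable_X_QG_subspace:
  fixes K :: "(('a::metric_space \<Rightarrow> complex) \<Rightarrow> complex) set"
  assumes "closedin (X_QG TYPE('a)) K" "countable S" "S \<subseteq> C_QG TYPE('a)"
    and "\<And>p q. \<lbrakk>p \<in> K; q \<in> K; p \<noteq> q\<rbrakk> \<Longrightarrow> \<exists>f\<in>S. p f \<noteq> q f"
  shows "metrizable_space (subtopology (X_QG TYPE('a)) K)"
  using closedin_compact_space[OF compact_X_QG assms(1)] assms(2-)
  unfolding X_QG_def by (rule metrizable_if_countably_separated)

theorem corollary4p6:
  fixes k M :: real and x0 :: "'a::metric_space"
  assumes "k \<ge> 1" and "M > 0"
    and "\<And>B :: 'a set. bounded B \<Longrightarrow>
           \<exists>\<F>. finite \<F> \<and> B \<subseteq> \<Union>\<F> \<and> (\<forall>U\<in>\<F>. bounded U \<and> diameter U < M)"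
    and "integrally_quasi_geodesic_space TYPE('a) k k"
  shows "compact_space (subtopology (X_QG TYPE('a)) (boundary_QG TYPE('a)))
       \<and> metrizable_space (subtopology (X_QG TYPE('a)) (boundary_QG TYPE('a)))
       \<and> (\<forall>p \<in> boundary_QG TYPE('a). \<exists>h :: nat \<Rightarrow> 'a.
            integral_quasi_geodesic_ray (k + 2 * M) (k + 2 * M) h \<and> h 1 = x0 \<and>
            limit_in_X_QG h p)
       \<and> (proper_space TYPE('a) \<longrightarrow>
            compact_space (X_QG TYPE('a)) \<and> metrizable_space (X_QG TYPE('a)))"
proof -
  let ?K = "k + 2 * M"
  let ?\<Omega> = "points_at_infinity TYPE('a)"
  have "\<exists>F. finite F \<and> x0 \<in> F \<and> (\<forall>x. dist x0 x \<le> k * real i + k \<longrightarrow> (\<exists>y\<in>F. dist x y < M))" for i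
  proof -
    obtain F where "finite F" "\<forall>x\<in>cball x0 (k * real i + k). \<exists>y\<in>F. dist x y < M"
      using finite_net_if_finite_cover[OF assms(3)[OF bounded_cball[of x0 "k * real i + k"]]]
      by (elim exE conjE)
    then show ?thesis by (intro exI[of _ "insert x0 F"]) auto
  qed
  then obtain F where F: "\<And>i. finite (F i)" "\<And>i. x0 \<in> F i"
    and net: "\<And>i x. dist x0 x \<le> k * real i + k \<Longrightarrow> \<exists>y\<in>F i. dist x y < M"
    by metis
  define \<C> where "\<C> = {cone x0 ?K ?K g m | g m. \<forall>i. g i \<in> F i}"
  have net_ray: "\<exists>g. (\<forall>i. g i \<in> F i) \<and> g 1 = x0 \<and> integral_quasi_geodesic_ray ?K ?K g \<and>
      (\<forall>m. adherent p (cone x0 ?K ?K g m))" if "p \<in> ?\<Omega>" for p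
    using point_at_infinity_is_limit_of_net_ray[OF assms(1,2) F net assms(4) that] .
  have limit_of_ray: "\<exists>g. integral_quasi_geodesic_ray ?K ?K g \<and> g 1 = x0 \<and> limit_in_X_QG g p"
    if p: "p \<in> ?\<Omega>" for p
  proof -
    obtain g where g: "g 1 = x0" "integral_quasi_geodesic_ray ?K ?K g"
        "\<And>m. adherent p (cone x0 ?K ?K g m)"
      using net_ray[OF p] by blast
    have "p \<in> characters (C_QG TYPE('a))"
      using p by (simp add: points_at_infinity_def)
    then have "limit_in_X_QG g p"
      using g by (intro adherent_cones_imp_limit[of ?K]) simp_all
    with g show ?thesis by blast
  qed
  have boundary: "boundary_QG TYPE('a) = ?\<Omega>"
  proof (cases "proper_space TYPE('a)")
    case True
    then show ?thesis by (simp only: boundary_QG_def if_True boundary_proper)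
  next
    case False
    then have "boundary_QG TYPE('a) = {p. \<exists>q Q g. integral_quasi_geodesic_ray q Q g \<and> limit_in_X_QG g p}"
      by (simp only: boundary_QG_def if_False)
    then show ?thesis
      using ray_limit_at_infinity limit_of_ray by blast
  qed
  have small: "\<exists>C\<in>\<C>. adherent p C \<and> (\<forall>x\<in>C. \<forall>y\<in>C. dist (f x) (f y) < \<epsilon>)"
    if p: "p \<in> ?\<Omega>" and f: "f \<in> C_QG TYPE('a)" and \<epsilon>: "\<epsilon> > 0" for p f \<epsilon>
  proof -
    obtain g where g: "\<forall>i. g i \<in> F i" "g 1 = x0" "integral_quasi_geodesic_ray ?K ?K g"
        "\<forall>m. adherent p (cone x0 ?K ?K g m)"
      using net_ray[OF p] by blast
    obtain m where "\<forall>x\<in>cone x0 ?K ?K g m. \<forall>y\<in>cone x0 ?K ?K g m. dist (f x) (f y) < \<epsilon>"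
      using C_QG_small_on_cone[OF f \<epsilon> g(3)] unfolding g(2) by blast
    moreover have "cone x0 ?K ?K g m \<in> \<C>" using g(1) by (auto simp: \<C>_def)
    ultimately show ?thesis using g(4) by blast
  qed
  have cnt: "countable \<C>"
    unfolding \<C>_def using F(1) by (rule countable_cones)
  have ch: "?\<Omega> \<subseteq> characters (C_QG TYPE('a))"
    by (auto simp: points_at_infinity_def)
  have "\<exists>S. countable S \<and> S \<subseteq> C_QG TYPE('a) \<and>
      (\<forall>p\<in>?\<Omega>. \<forall>q\<in>?\<Omega>. p \<noteq> q \<longrightarrow> (\<exists>f\<in>S. p f \<noteq> q f))"
    by (rule countable_separating_family[OF cnt _ ch]) (rule small)
  then obtain S where S: "countable S" "S \<subseteq> C_QG TYPE('a)"
      "\<forall>p\<in>?\<Omega>. \<forall>q\<in>?\<Omega>. p \<noteq> q \<longrightarrow> (\<exists>f\<in>S. p f \<noteq> q f)"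
    by (elim exE conjE)
  have "metrizable_space (subtopology (X_QG TYPE('a)) ?\<Omega>)"
    using S(3) by (intro metrizable_X_QG_subspace[OF closedin_points_at_infinity S(1,2)]) blast
  moreover have "compact_space (subtopology (X_QG TYPE('a)) ?\<Omega>)"
    by (intro compact_space_subtopology closedin_compact_space compact_X_QG closedin_points_at_infinity)
  moreover have "metrizable_space (X_QG TYPE('a))" if proper: "proper_space TYPE('a)"
  proof -
    obtain B where B: "countable B" "B \<subseteq> C_QG TYPE('a)"
      and pt: "\<forall>x :: 'a. \<forall>\<epsilon>>0. \<exists>f\<in>B. f x \<noteq> 0 \<and> (\<forall>y. \<epsilon> \<le> dist x y \<longrightarrow> f y = 0) \<and> (\<forall>q\<in>?\<Omega>. q f = 0)"
      using countable_family_separating_points[OF proper] by (elim exE conjE)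
    have top: "topspace (X_QG TYPE('a)) = range to_X_QG \<union> ?\<Omega>"
      using boundary_proper[OF proper] to_X_QG_in_characters
      by (auto simp: X_QG_def)
    have eval: "\<exists>f\<in>B. to_X_QG x f \<noteq> q f"
      if q: "q \<in> topspace (X_QG TYPE('a))" "q \<noteq> to_X_QG x" for x :: 'a and q
    proof (cases "q \<in> ?\<Omega>")
      case True
      obtain f where "f \<in> B" "f x \<noteq> 0" "q f = 0" using pt True zero_less_one by blast
      then show ?thesis using B(2) by (intro bexI[of _ f]) (auto simp: to_X_QG_def)
    next
      case False
      then obtain y where y: "q = to_X_QG y" using q(1) top by blast
      then have "dist x y > 0" using q(2) by auto
      then obtain f where "f \<in> B" "f x \<noteq> 0" "f y = 0" using pt by blast
      then show ?thesis using B(2) y by (intro bexI[of _ f]) (auto simp: to_X_QG_def)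
    qed
    have sep: "\<exists>f\<in>S \<union> B. p f \<noteq> q f"
      if pq: "p \<in> topspace (X_QG TYPE('a))" "q \<in> topspace (X_QG TYPE('a))" "p \<noteq> q" for p q
    proof -
      consider x where "p = to_X_QG x" | x where "q = to_X_QG x" | "p \<in> ?\<Omega>" "q \<in> ?\<Omega>"
        using pq top by blast
      then show ?thesis
      proof cases
        case 1
        then show ?thesis using eval[OF pq(2), of x] pq(3) by auto
      next
        case 2
        then show ?thesis using eval[OF pq(1), of x] pq(3) by fastforce
      next
        case 3
        then show ?thesis using S(3) pq(3) by blast
      qed
    qed
    have "metrizable_space (subtopology (X_QG TYPE('a)) (topspace (X_QG TYPE('a))))"
      using S(1,2) B sep
      by (intro metrizable_X_QG_subspace[OF closedin_topspace, of "S \<union> B"]) auto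
    then show ?thesis by (simp only: subtopology_topspace)
  qed
  ultimately show ?thesis
    unfolding boundary using limit_of_ray compact_X_QG by blast
qed

end
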